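(* Let $T$ be a bounded linear operator in a Banach space $B$, and let $h\in B$. The equation $$Tf-f=h$$ has an almost periodic solution $f\in B$ if and only if the set of sums $$s_n=\sum_{k=0}^nT^kh,\quad n\ge0,$$ is precompact in $B$. Under this condition all solutions $f\in B$ of the equation are almost periodic.
   Context: A vector $v\in B$ is called almost periodic (with respect to $T$) if its orbit $\{T^nv:n\ge0\}$ is precompact in $B$, i.e. has compact closure in the norm topology. *)

theory Defs
  imports "HOL-Analysis.Analysis"
begin

definition precompact :: "'a::topological_space set \<Rightarrow> bool" where
  "precompact S \<longleftrightarrow> compact (closure S)"

definition almost_periodic :: "('a::topological_space \<Rightarrow> 'a) \<Rightarrow> 'a \<Rightarrow> bool" where
  "almost_periodic T v \<longleftrightarrow> precompact (range (\<lambda>n. (T ^^ n) v))"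

end

theory Submission
  imports Defs
begin

text \<open>
  If \<open>T f - f = h\<close>, the sums telescope to \<open>T\<^sup>n\<^sup>+\<^sup>1 f - f\<close>. Up to its first term, the orbit of any
  solution is therefore a translate of the set of sums, and each is precompact exactly when the
  other is. This settles everything except the existence of a solution when the sums
  \<open>s\<^sub>n\<close> are precompact.

  For existence, note that \<open>- f\<close> is a solution exactly when \<open>f\<close> is a fixed point of the continuous
  affine map \<open>A x = T x + h\<close>, and that \<open>A\<close> shifts the sequence: \<open>A s\<^sub>n = s\<^sub>n\<^sub>+\<^sub>1\<close>. The Cesaro means of
  \<open>s\<close> are almost fixed by \<open>A\<close>, because \<open>A\<close> changes them only by the two boundary terms
  divided by \<open>n\<close>, and \<open>s\<close> is bounded. The means lie in the convex hull of the \<open>s\<^sub>n\<close>, which is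
  precompact by Mazur's theorem (this is where completeness of the space enters), so a
  subsequence of them converges, and its limit is a fixed point of \<open>A\<close>.
\<close>

lemma precompact_subset_compact:
  fixes S K :: "'a::t2_space set"
  assumes "S \<subseteq> K" "compact K"
  shows "precompact S"
proof -
  have "closure S \<subseteq> K"
    by (simp add: assms closure_minimal compact_imp_closed)
  then have "closure S = K \<inter> closure S" by blast
  moreover have "compact (K \<inter> closure S)"
    using assms(2) by (simp add: compact_Int_closed)
  ultimately show ?thesis by (simp add: precompact_def)
qed

text \<open>Mazur's theorem. Total boundedness passes to the convex hull because the hull of an
  \<open>\<epsilon>\<close>-neighbourhood of a finite set is contained in the \<open>\<epsilon>\<close>-neighbourhood of the hull of that
  finite set, and the latter hull is compact.\<close>
lemma precompact_convex_hull:
  fixes S :: "'a::banach set"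
  assumes "precompact S"
  shows "precompact (convex hull S)"
  unfolding precompact_def compact_eq_totally_bounded
proof (intro conjI allI impI)
  show "complete (closure (convex hull S))"
    by (simp add: complete_eq_closed)
next
  fix e :: real
  assume e: "e > 0"
  \<comment> \<open>One third each for leaving \<open>S\<close>, for covering the compact hull of the finite net, and for
    passing to the closure.\<close>
  define d where "d = e / 3"
  have d: "d > 0" using e by (simp add: d_def)
  obtain F where F: "finite F" "closure S \<subseteq> (\<Union>x\<in>F. ball x d)"
    using assms d unfolding precompact_def compact_eq_totally_bounded by blast
  obtain G where G: "finite G" "convex hull F \<subseteq> (\<Union>x\<in>G. ball x d)"
    using finite_imp_compact_convex_hull[OF F(1)] d
    unfolding compact_eq_totally_bounded by blast
  have "S \<subseteq> (\<Union>x\<in>convex hull F. \<Union>y\<in>ball 0 d. {x + y})"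
  proof
    fix z assume "z \<in> S"
    then obtain x where x: "x \<in> F" "z \<in> ball x d"
      using F(2) closure_subset by blast
    then have "x \<in> convex hull F" "z - x \<in> ball 0 d" "z = x + (z - x)"
      by (auto simp: hull_inc dist_norm norm_minus_commute)
    then show "z \<in> (\<Union>x\<in>convex hull F. \<Union>y\<in>ball 0 d. {x + y})" by blast
  qed
  then have hull: "convex hull S \<subseteq> (\<Union>x\<in>convex hull F. \<Union>y\<in>ball 0 d. {x + y})"
    by (simp add: hull_minimal convex_sums)
  show "\<exists>k. finite k \<and> closure (convex hull S) \<subseteq> (\<Union>x\<in>k. ball x e)"
  proof (intro exI conjI subsetI)
    show "finite G" by (fact G(1))
    fix z assume "z \<in> closure (convex hull S)"
    then obtain w where w: "w \<in> convex hull S" "dist w z < d"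
      using d by (auto simp: closure_approachable)
    then obtain x y where xy: "x \<in> convex hull F" "norm y < d" "w = x + y"
      using hull by fastforce
    then obtain g where g: "g \<in> G" "dist g x < d"
      using G(2) by fastforce
    have "dist x w < d" using xy by (simp add: dist_norm)
    then have "dist g z < d + d + d"
      using w(2) g(2) dist_triangle[of g z x] dist_triangle[of x z w] by linarith
    then show "z \<in> (\<Union>x\<in>G. ball x e)"
      using g(1) by (auto simp: d_def)
  qed
qed

text \<open>The fixed point is a subsequential limit of the Cesaro means \<open>m\<close> of the orbit \<open>s\<close>. An affine
  map commutes with taking means, so applying \<open>\<lambda>x. T x + h\<close> to \<open>m n\<close> shifts the averaged
  block by one index, and \<open>m n\<close> moves by \<open>O(1/n)\<close> only.\<close>
lemma precompact_affine_orbit_imp_fixed_point: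
  fixes T :: "'a::banach \<Rightarrow> 'a"
  assumes T: "bounded_linear T"
    and s: "\<And>n. s (Suc n) = T (s n) + h"
    and pc: "precompact (range s)"
  shows "\<exists>x. T x + h = x"
proof -
  interpret bounded_linear T by (fact T)
  define m where "m n = (1 / real (Suc n)) *\<^sub>R (\<Sum>k\<le>n. s k)" for n
  have drift: "T (m n) + h - m n = (1 / real (Suc n)) *\<^sub>R (s (Suc n) - s 0)" for n
  proof -
    have "T (m n) + h = (1 / real (Suc n)) *\<^sub>R (\<Sum>k\<le>n. T (s k) + h)"
      by (simp add: m_def scaleR sum sum.distrib scaleR_add_right sum_constant_scaleR
          del: of_nat_Suc)
    also have "\<dots> = (1 / real (Suc n)) *\<^sub>R (\<Sum>k\<le>n. s (Suc k))"
      by (simp add: s)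
    finally have "T (m n) + h - m n = (1 / real (Suc n)) *\<^sub>R (\<Sum>k\<le>n. s (Suc k) - s k)"
      by (simp add: m_def scaleR_diff_right sum_subtractf)
    also have "(\<Sum>k\<le>n. s (Suc k) - s k) = s (Suc n) - s 0"
      by (induction n) simp_all
    finally show ?thesis .
  qed
  have "bounded (range s)"
    using bounded_subset[OF compact_imp_bounded closure_subset] pc
    unfolding precompact_def by simp
  then obtain C where C: "\<And>n. norm (s n) \<le> C"
    unfolding bounded_iff by auto
  have "(\<lambda>n. T (m n) + h - m n) \<longlonglongrightarrow> 0"
  proof (rule Lim_null_comparison)
    show "\<forall>\<^sub>F n in sequentially. norm (T (m n) + h - m n) \<le> 2 * C * inverse (real (Suc n))"
    proof (intro always_eventually allI)
      fix n
      have "norm (s (Suc n) - s 0) \<le> 2 * C"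
        using norm_triangle_ineq4[of "s (Suc n)" "s 0"] C[of "Suc n"] C[of 0] by linarith
      then show "norm (T (m n) + h - m n) \<le> 2 * C * inverse (real (Suc n))"
        unfolding drift by (simp add: divide_simps)
    qed
    show "(\<lambda>n. 2 * C * inverse (real (Suc n))) \<longlonglongrightarrow> 0"
      by (intro tendsto_mult_right_zero LIMSEQ_inverse_real_of_nat)
  qed
  moreover have "m n \<in> closure (convex hull (range s))" for n
  proof -
    have "(\<Sum>k\<le>n. (1 / real (Suc n)) *\<^sub>R s k) \<in> convex hull (range s)"
      by (intro convex_sum) (auto simp: hull_inc)
    then show ?thesis
      using closure_subset by (auto simp: m_def scaleR_sum_right)
  qed
  then obtain x r where r: "strict_mono r" "(m \<circ> r) \<longlonglongrightarrow> x"
    using precompact_convex_hull[OF pc] unfolding precompact_def compact_def by blast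
  ultimately have "(\<lambda>n. T ((m \<circ> r) n) + h - (m \<circ> r) n) \<longlonglongrightarrow> 0"
    using LIMSEQ_subseq_LIMSEQ[of "\<lambda>n. T (m n) + h - m n" 0 r] by (simp add: o_def)
  moreover have "(\<lambda>n. T ((m \<circ> r) n) + h - (m \<circ> r) n) \<longlonglongrightarrow> T x + h - x"
    by (intro tendsto_intros tendsto r(2))
  ultimately have "T x + h - x = 0"
    using LIMSEQ_unique by blast
  then show ?thesis by auto
qed

text \<open>The sums telescope, so the orbit of a solution and the set of sums differ by a translation
  and the single point \<open>f\<close>.\<close>
lemma almost_periodic_iff_precompact_sums:
  fixes T :: "'a::real_normed_vector \<Rightarrow> 'a"
  assumes T: "linear T" and f: "T f - f = h"
  shows "almost_periodic T f \<longleftrightarrow> precompact (range (\<lambda>n. \<Sum>k=0..n. (T ^^ k) h))"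
    (is "_ \<longleftrightarrow> precompact (range ?s)")
proof -
  have step: "(T ^^ k) h = (T ^^ Suc k) f - (T ^^ k) f" for k
  proof (induction k)
    case 0
    then show ?case by (simp add: f)
  next
    case (Suc k)
    then show ?case by (simp add: linear_diff[OF T])
  qed
  have tele: "(T ^^ Suc n) f = f + ?s n" for n
    unfolding step by (subst sum_Suc_diff) simp_all
  show ?thesis
    unfolding almost_periodic_def
  proof
    let ?C = "closure (range (\<lambda>n. (T ^^ n) f))"
    assume "precompact (range (\<lambda>n. (T ^^ n) f))"
    then have "compact ((+) (- f) ` ?C)"
      unfolding precompact_def by (rule compact_translation)
    moreover have "range ?s \<subseteq> (+) (- f) ` ?C"
    proof (intro image_subsetI)
      fix n
      have "(T ^^ Suc n) f \<in> ?C" by (rule subsetD[OF closure_subset]) (rule rangeI)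
      moreover have "?s n = - f + (T ^^ Suc n) f" by (subst tele) simp
      ultimately show "?s n \<in> (+) (- f) ` ?C" by (rule rev_image_eqI)
    qed
    ultimately show "precompact (range ?s)" by (rule precompact_subset_compact[rotated])
  next
    let ?C = "closure (range ?s)"
    assume "precompact (range ?s)"
    then have "compact (insert f ((+) f ` ?C))"
      unfolding precompact_def by (intro compact_insert compact_translation)
    moreover have "range (\<lambda>n. (T ^^ n) f) \<subseteq> insert f ((+) f ` ?C)"
    proof (intro image_subsetI)
      fix n
      show "(T ^^ n) f \<in> insert f ((+) f ` ?C)"
      proof (cases n)
        case (Suc k)
        have "?s k \<in> ?C" by (rule subsetD[OF closure_subset]) (rule rangeI)
        then show ?thesis unfolding Suc tele by (intro insertI2 imageI)
      qed simp
    qed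
    ultimately show "precompact (range (\<lambda>n. (T ^^ n) f))"
      by (rule precompact_subset_compact[rotated])
  qed
qed

theorem theorem8p1:
  fixes T :: "'b::banach \<Rightarrow> 'b" and h :: 'b
  assumes "bounded_linear T"
  shows "((\<exists>f. T f - f = h \<and> almost_periodic T f) \<longleftrightarrow>
            precompact (range (\<lambda>n. \<Sum>k=0..n. (T ^^ k) h))) \<and>
         (precompact (range (\<lambda>n. \<Sum>k=0..n. (T ^^ k) h)) \<longrightarrow>
            (\<forall>f. T f - f = h \<longrightarrow> almost_periodic T f))"
proof -
  let ?s = "\<lambda>n. \<Sum>k=0..n. (T ^^ k) h"
  have lin: "linear T" using assms by (rule bounded_linear.linear)
  have "?s (Suc n) = T (?s n) + h" for n
  proof (induction n)
    case 0
    then show ?case by simp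
  next
    case (Suc n)
    have "?s (Suc (Suc n)) = ?s (Suc n) + T ((T ^^ Suc n) h)"
      by simp
    also have "\<dots> = T (?s n) + T ((T ^^ Suc n) h) + h"
      unfolding Suc.IH by (simp only: ac_simps)
    also have "T (?s n) + T ((T ^^ Suc n) h) = T (?s (Suc n))"
      by (simp add: linear_add[OF lin])
    finally show ?case .
  qed
  then have fixed: "\<exists>x. T x + h = x" if "precompact (range ?s)"
    using precompact_affine_orbit_imp_fixed_point[of T ?s h] assms that by blast
  have "\<exists>f. T f - f = h" if pc: "precompact (range ?s)"
  proof -
    obtain x where "T x + h = x" using fixed[OF pc] ..
    then have "T (- x) - (- x) = h"
      by (simp add: linear_neg[OF lin] algebra_simps)
    then show ?thesis ..
  qed
  then show ?thesis
    using almost_periodic_iff_precompact_sums[OF lin] by blast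
qed

end
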